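(* For every sufficiently large constant $d$ there is a constant $\gamma>0$ such that a uniformly random $2d$-regular (simple) graph on vertex set $[n]$ is $\gamma$-robustly self-ordered with probability $1-o(1)$ (as $n\to\infty$).
   Context: A graph $G=(V,E)$ is $\gamma$-robustly self-ordered if for every permutation $\pi:V\to V$, $|E\triangle\{\{\pi(u),\pi(v)\}:\{u,v\}\in E\}|\ge\gamma\cdot|\{v:\pi(v)\ne v\}|$. *)

theory Defs
  imports "HOL-Probability.Probability_Mass_Function" "HOL-Combinatorics.Permutations"
begin

text \<open>A simple graph is a finite vertex set \<open>V\<close> with an edge set \<open>E\<close> of two-element subsets
  of \<open>V\<close>, so there are neither loops nor parallel edges.\<close>

definition simple_graph :: "'a set \<Rightarrow> 'a set set \<Rightarrow> bool" where
  "simple_graph V E \<longleftrightarrow> finite V \<and> (\<forall>e\<in>E. e \<subseteq> V \<and> card e = 2)"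

definition degree :: "'a set set \<Rightarrow> 'a \<Rightarrow> nat" where
  "degree E v = card {e \<in> E. v \<in> e}"

definition regular_graph :: "nat \<Rightarrow> 'a set \<Rightarrow> 'a set set \<Rightarrow> bool" where
  "regular_graph k V E \<longleftrightarrow> simple_graph V E \<and> (\<forall>v\<in>V. degree E v = k)"

definition robustly_self_ordered :: "real \<Rightarrow> 'a set \<Rightarrow> 'a set set \<Rightarrow> bool" where
  "robustly_self_ordered \<gamma> V E \<longleftrightarrow>
     (\<forall>\<pi>. \<pi> permutes V \<longrightarrow>
        real (card (sym_diff E {{\<pi> u, \<pi> v} | u v. {u, v} \<in> E}))
          \<ge> \<gamma> * real (card {v \<in> V. \<pi> v \<noteq> v}))"

text \<open>The uniform distribution on the edge sets of the labelled \<open>k\<close>-regular simple graphs with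
  vertex set \<open>{1..n}\<close>. For even \<open>k\<close> such graphs exist as soon as \<open>n > k\<close>; for the
  remaining positive \<open>n\<close> the set is empty and the value of \<open>pmf_of_set\<close> is unspecified,
  which does not affect limits as \<open>n\<close> tends to infinity.\<close>

definition random_regular_graph :: "nat \<Rightarrow> nat \<Rightarrow> nat set set pmf" where
  "random_regular_graph k n = pmf_of_set {E. regular_graph k {1..n} E}"

end

theory Submission
  imports Defs
begin

text \<open>Let \<open>k = 2 d \<ge> 16\<close>; already \<open>\<gamma> = 1\<close> works. If \<open>\<pi>\<close> moves exactly the \<open>t\<close> vertices in
  \<open>T\<close> and changes fewer than \<open>t\<close> edges, then among the at least \<open>k t / 2\<close> edges meeting \<open>T\<close> at most
  \<open>t\<close> are fixed by \<open>\<pi>\<close> and fewer than \<open>t\<close> are mapped to non-edges, so there are \<open>2 t\<close> edges \<open>A\<close>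
  meeting \<open>T\<close> such that \<open>A\<close> and \<open>\<pi> A\<close> are disjoint sets of edges. Edge switchings bound the
  probability that a random regular graph contains a prescribed set of \<open>4 t\<close> edges by
  \<open>(4 k / n)^(4 t)\<close>. There are at most \<open>n^t\<close> choices of \<open>T\<close> and \<open>\<pi>\<close>, and at most
  \<open>(t n choose 2 t) \<le> (e n\<^sup>2)^t\<close> choices of \<open>A\<close>, so the failure probability is
  at most the sum of \<open>(e (4 k)^4 / n)^t\<close> over \<open>t \<ge> 1\<close>, which is \<open>O(1/n)\<close>.\<close>

section \<open>Edges, neighbours and degrees in simple graphs\<close>

lemma simple_graph_finite_edges:
  assumes "simple_graph V E"
  shows "finite E"
proof -
  have "E \<subseteq> Pow V" "finite V" using assms by (auto simp: simple_graph_def)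
  then show ?thesis by (meson finite_Pow_iff finite_subset)
qed

lemma simple_graph_edgeD:
  assumes "simple_graph V E" "{x, y} \<in> E"
  shows "x \<noteq> y" "x \<in> V" "y \<in> V"
  using assms by (auto simp: simple_graph_def card_insert_if split: if_splits)

lemma edges_at_vertex:
  assumes "simple_graph V E"
  shows "{e \<in> E. x \<in> e} = (\<lambda>y. {x, y}) ` {y. {x, y} \<in> E}"
proof -
  have "\<exists>y. e = {x, y}" if "e \<in> E" "x \<in> e" for e
  proof -
    have "card e = 2" using assms that by (auto simp: simple_graph_def)
    then obtain a b where "e = {a, b}" by (auto simp: card_2_iff)
    with that(2) show ?thesis by auto
  qed
  then show ?thesis by blast
qed

lemma card_neighbours:
  assumes "simple_graph V E"
  shows "card {y. {x, y} \<in> E} = degree E x"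
proof -
  have "inj_on (\<lambda>y. {x, y}) {y. {x, y} \<in> E}"
    by (auto simp: inj_on_def doubleton_eq_iff)
  then show ?thesis
    unfolding degree_def edges_at_vertex[OF assms] by (simp add: card_image)
qed

lemma finite_neighbours:
  assumes "simple_graph V E"
  shows "finite {y. {x, y} \<in> E}"
  by (rule finite_subset[of _ V])
     (use assms simple_graph_edgeD[OF assms] in \<open>auto simp: simple_graph_def\<close>)

lemma degree_insert:
  assumes "finite E" "e \<notin> E"
  shows "degree (insert e E) w = degree E w + of_bool (w \<in> e)"
proof -
  have "{f \<in> insert e E. w \<in> f} = (if w \<in> e then insert e {f \<in> E. w \<in> f} else {f \<in> E. w \<in> f})"
    by auto
  then show ?thesis using assms by (simp add: degree_def)
qed

section \<open>Edge switchings and prescribed edges\<close>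

text \<open>Each of \<open>u\<close>, \<open>v\<close>, \<open>x\<close>, \<open>y\<close> loses one
  edge and gains one. The non-edge hypotheses rule out parallel edges, the two inequalities rule out
  loops.\<close>

lemma regular_graph_switch:
  assumes reg: "regular_graph k V E"
    and E: "{u, v} \<in> E" "{x, y} \<in> E" "{u, x} \<notin> E" "{v, y} \<notin> E"
    and "x \<noteq> u" "y \<noteq> v"
  shows "regular_graph k V (E - {{u, v}, {x, y}} \<union> {{u, x}, {v, y}})"
proof -
  have simple: "simple_graph V E" using reg by (simp add: regular_graph_def)
  note D = simple_graph_edgeD[OF simple E(1)] simple_graph_edgeD[OF simple E(2)]
  define C where "C = E - {{u, v}, {x, y}}"
  have fin: "finite C" unfolding C_def using simple_graph_finite_edges[OF simple] by simp
  \<comment> \<open>\<open>x = v\<close> would turn the non-edge \<open>{u, x}\<close> into the edge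
    \<open>{u, v}\<close>, and \<open>y = u\<close> would do the same to
    \<open>{v, y}\<close>.\<close>
  have ne: "x \<noteq> v" "y \<noteq> u" using E by (auto simp: insert_commute)
  have E1: "E = insert {u, v} (insert {x, y} C)" unfolding C_def using E by auto
  have E2: "E - {{u, v}, {x, y}} \<union> {{u, x}, {v, y}} = insert {u, x} (insert {v, y} C)"
    unfolding C_def by auto
  have new: "{u, x} \<notin> insert {v, y} C" "{v, y} \<notin> C"
    using E ne D by (auto simp: C_def doubleton_eq_iff)
  have old: "{u, v} \<notin> insert {x, y} C" "{x, y} \<notin> C"
    using assms ne by (auto simp: C_def doubleton_eq_iff)
  have "degree (insert {u, x} (insert {v, y} C)) w = degree E w" for w
    unfolding E1 using fin new old ne D assms by (simp add: degree_insert)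
  then show ?thesis
    using reg D assms(6,7) unfolding E2 regular_graph_def simple_graph_def
    by (auto simp: C_def)
qed

text \<open>A two-element set has two orderings, a singleton one, any other set none;
  \<open>F\<close> is an arbitrary finite family, hence only an upper bound.\<close>

lemma card_ordered_edges_le:
  assumes "finite F"
  shows "finite {(x, y). {x, y} \<in> F} \<and> card {(x, y). {x, y} \<in> F} \<le> 2 * card F"
proof -
  have *: "finite {(x, y). {x, y} = f} \<and> card {(x, y). {x, y} = f} \<le> 2" for f :: "'a set"
  proof (cases "\<exists>a b. f = {a, b}")
    case True
    then obtain a b where f: "f = {a, b}" by blast
    have sub: "{(x, y). {x, y} = f} \<subseteq> set [(a, b), (b, a)]"
      unfolding f by (auto simp: doubleton_eq_iff)
    have "card {(x, y). {x, y} = f} \<le> card (set [(a, b), (b, a)])"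
      by (rule card_mono[OF _ sub]) simp
    also have "\<dots> \<le> 2" using card_length[of "[(a, b), (b, a)]"] by simp
    finally show ?thesis using finite_subset[OF sub] by simp
  next
    case False
    then have "{(x, y). {x, y} = f} = {}" by auto
    then show ?thesis by simp
  qed
  have eq: "{(x, y). {x, y} \<in> F} = (\<Union>f\<in>F. {(x, y). {x, y} = f})" by auto
  have "card {(x, y). {x, y} \<in> F} \<le> (\<Sum>f\<in>F. card {(x, y). {x, y} = f})"
    unfolding eq by (rule card_UN_le[OF assms])
  also have "\<dots> \<le> (\<Sum>f\<in>F. 2)" by (rule sum_mono) (use * in blast)
  finally have "card {(x, y). {x, y} \<in> F} \<le> 2 * card F" by simp
  moreover have "finite {(x, y). {x, y} \<in> F}" unfolding eq using assms * by blast
  ultimately show ?thesis by blast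
qed

text \<open>There are \<open>k + 1\<close> starting vertices, \<open>u\<close> and its neighbours,
  with \<open>k\<close> second endpoints each. A switching at \<open>u\<close> has to avoid these
  ordered edges.\<close>

lemma ordered_edges_near_vertex:
  assumes reg: "regular_graph k V E" and "u \<in> V"
  defines "B \<equiv> SIGMA x:insert u {y. {u, y} \<in> E}. {y. {x, y} \<in> E}"
  shows "finite B \<and> card B \<le> k * (k + 1)"
proof -
  have simple: "simple_graph V E" using reg by (simp add: regular_graph_def)
  have deg: "card {y. {x, y} \<in> E} = k" if "x \<in> V" for x
    using that card_neighbours[OF simple, of x] reg by (simp add: regular_graph_def)
  have fin: "finite (insert u {y. {u, y} \<in> E})" using finite_neighbours[OF simple] by simp
  have sub: "insert u {y. {u, y} \<in> E} \<subseteq> V"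
    using assms simple_graph_edgeD[OF simple] by auto
  have "card B = (\<Sum>x\<in>insert u {y. {u, y} \<in> E}. card {y. {x, y} \<in> E})"
    unfolding B_def using fin finite_neighbours[OF simple] by simp
  also have "\<dots> = (\<Sum>x\<in>insert u {y. {u, y} \<in> E}. k)"
    by (rule sum.cong) (use sub deg in auto)
  also have "\<dots> \<le> k * (k + 1)"
    using deg[OF assms(2)] finite_neighbours[OF simple, of u] by (simp add: card_insert_if)
  finally show ?thesis using fin finite_neighbours[OF simple] by (simp add: B_def)
qed

text \<open>Of the \<open>k * card V\<close> ordered edges, only those in \<open>F\<close>, those
  starting at or next to \<open>u\<close> and those ending at or next to \<open>v\<close> are lost.
  Subtraction is truncated, so the bound is trivial for small \<open>V\<close>.\<close>

lemma card_switchable_edges_ge: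
  assumes reg: "regular_graph k V E" and F: "insert {u, v} F \<subseteq> E"
  defines "S \<equiv> {(x, y). {x, y} \<in> E - F \<and> {u, x} \<notin> E \<and> {v, y} \<notin> E \<and> x \<noteq> u \<and> y \<noteq> v}"
  shows "finite S \<and> k * card V - 2 * card F - 2 * k * (k + 1) \<le> card S"
proof -
  have simple: "simple_graph V E" using reg by (simp add: regular_graph_def)
  then have finV: "finite V" by (simp add: simple_graph_def)
  have uv: "u \<in> V" "v \<in> V" using simple_graph_edgeD[OF simple, of u v] F by auto
  have finF: "finite F" using F simple_graph_finite_edges[OF simple] by (meson finite_insert finite_subset)
  define A where "A = {(x, y). {x, y} \<in> E}"
  define B1 where "B1 = {(x, y). {x, y} \<in> F}"
  define B2 where "B2 = (SIGMA x:insert u {y. {u, y} \<in> E}. {y. {x, y} \<in> E})"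
  define B3 where "B3 = (SIGMA x:insert v {y. {v, y} \<in> E}. {y. {x, y} \<in> E})"
  have finA: "finite A"
    unfolding A_def using card_ordered_edges_le simple_graph_finite_edges[OF simple] by blast
  have "A = (SIGMA x:V. {y. {x, y} \<in> E})"
    unfolding A_def using simple_graph_edgeD[OF simple] by auto
  then have "card A = (\<Sum>x\<in>V. card {y. {x, y} \<in> E})"
    using finV finite_neighbours[OF simple] by simp
  also have "\<dots> = (\<Sum>x\<in>V. k)"
    by (rule sum.cong) (use card_neighbours[OF simple] reg in \<open>auto simp: regular_graph_def\<close>)
  finally have cA: "card A = k * card V" by simp
  have c1: "finite B1" "card B1 \<le> 2 * card F"
    unfolding B1_def using card_ordered_edges_le[OF finF] by auto
  have c2: "finite B2" "card B2 \<le> k * (k + 1)"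
    unfolding B2_def using ordered_edges_near_vertex[OF reg uv(1)] by blast+
  have c3: "finite B3" "card B3 \<le> k * (k + 1)"
    unfolding B3_def using ordered_edges_near_vertex[OF reg uv(2)] by blast+
  have c3': "card (prod.swap ` B3) \<le> k * (k + 1)"
    using c3 card_image_le le_trans by blast
  \<comment> \<open>\<open>B3\<close> lists its pairs from the endpoint near \<open>v\<close>, which
    is the second one in \<open>S\<close>; hence the swap.\<close>
  have "A \<subseteq> S \<union> (B1 \<union> (B2 \<union> prod.swap ` B3))"
    by (auto simp: A_def S_def B1_def B2_def B3_def insert_commute image_iff)
  moreover have finS: "finite S" by (rule finite_subset[OF _ finA]) (auto simp: S_def A_def)
  ultimately have "card A \<le> card (S \<union> (B1 \<union> (B2 \<union> prod.swap ` B3)))"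
    using c1 c2 c3 by (intro card_mono) auto
  also have "\<dots> \<le> card S + (card B1 + (card B2 + card (prod.swap ` B3)))"
    by (meson card_Un_le add_le_mono le_trans order_refl)
  finally have "card A \<le> card S + (2 * card F + (k * (k + 1) + k * (k + 1)))"
    using c1 c2 c3' by linarith
  then show ?thesis using cA finS by (simp add: algebra_simps)
qed

lemma finite_regular_graphs:
  assumes "finite V"
  shows "finite {E. regular_graph k V E \<and> P E}"
  by (rule finite_subset[of _ "Pow (Pow V)"])
     (use assms in \<open>auto simp: regular_graph_def simple_graph_def\<close>)

text \<open>Switching the prescribed edge \<open>{u, v}\<close> with another edge \<open>{x, y}\<close> is injective once \<open>(x, y)\<close>
  is remembered, and \<open>(x, y)\<close> ranges over pairs of neighbours of \<open>u\<close> and \<open>v\<close> in the new graph.\<close>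

lemma card_regular_graphs_insert_edge:
  assumes "finite V" "e \<notin> F"
  shows "card {E. regular_graph k V E \<and> insert e F \<subseteq> E} * (k * card V - 2 * card F - 2 * k * (k + 1))
    \<le> k\<^sup>2 * card {E. regular_graph k V E \<and> F \<subseteq> E}"
proof (cases "\<exists>u v. e = {u, v}")
  case False
  have "{E. regular_graph k V E \<and> insert e F \<subseteq> E} = {}"
  proof -
    have "\<exists>u v. e = {u, v}" if "regular_graph k V E" "e \<in> E" for E
    proof -
      have "card e = 2" using that by (simp add: regular_graph_def simple_graph_def)
      then show ?thesis by (auto simp: card_2_iff)
    qed
    with False show ?thesis by auto
  qed
  then show ?thesis by (simp only: card.empty mult_0)
next
  case True
  then obtain u v where e: "e = {u, v}" by blast
  define R1 where "R1 = {E. regular_graph k V E \<and> insert e F \<subseteq> E}"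
  define R2 where "R2 = {E. regular_graph k V E \<and> F \<subseteq> E}"
  define S where "S = (\<lambda>E. {(x, y). {x, y} \<in> E - F \<and> {u, x} \<notin> E \<and> {v, y} \<notin> E \<and> x \<noteq> u \<and> y \<noteq> v})"
  define N where "N = (\<lambda>E. {y. {u, y} \<in> E} \<times> {y. {v, y} \<in> E})"
  define sw where "sw = (\<lambda>(E, x, y). (E - {{u, v}, {x, y}} \<union> {{u, x}, {v, y}}, x, y))"
  have fin: "finite R1" "finite R2"
    unfolding R1_def R2_def using finite_regular_graphs[OF assms(1)] by blast+
  have S: "finite (S E)" "k * card V - 2 * card F - 2 * k * (k + 1) \<le> card (S E)" if "E \<in> R1" for E
    using that card_switchable_edges_ge[of k V E u v F] by (auto simp: R1_def S_def e)
  show ?thesis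
  proof (cases "R1 = {}")
    case True
    then show ?thesis by (simp only: R1_def card.empty mult_0)
  next
    case False
    \<comment> \<open>A graph containing \<open>e\<close> is what shows that \<open>u\<close> and
      \<open>v\<close> are vertices and so have degree \<open>k\<close>; hence the case distinction
      on \<open>R1\<close>.\<close>
    then have uv: "u \<in> V" "v \<in> V"
      using simple_graph_edgeD[of V _ u v] by (auto simp: R1_def e regular_graph_def)
    have N: "finite (N E) \<and> card (N E) = k\<^sup>2" if "E \<in> R2" for E
    proof -
      have "simple_graph V E" "degree E u = k" "degree E v = k"
        using that uv by (auto simp: R2_def regular_graph_def)
      then show ?thesis
        unfolding N_def
        by (simp add: card_cartesian_product card_neighbours finite_neighbours power2_eq_square)
    qed
    have inj: "inj_on sw (Sigma R1 S)"
    proof (rule inj_onI)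
      fix p q assume "p \<in> Sigma R1 S" "q \<in> Sigma R1 S" "sw p = sw q"
      moreover have "\<exists>E x y. p = (E, x, y)" "\<exists>E x y. q = (E, x, y)" by (metis surj_pair)+
      ultimately obtain E E' x y where pq: "p = (E, x, y)" "q = (E', x, y)"
        "(E, x, y) \<in> Sigma R1 S" "(E', x, y) \<in> Sigma R1 S"
        and eq: "E - {{u, v}, {x, y}} \<union> {{u, x}, {v, y}} = E' - {{u, v}, {x, y}} \<union> {{u, x}, {v, y}}"
        by (auto simp: sw_def)
      \<comment> \<open>Undoing the switching recovers \<open>G\<close>, because
        \<open>{u, x}\<close> and \<open>{v, y}\<close> are not in \<open>G\<close> while
        \<open>{u, v}\<close> and \<open>{x, y}\<close> are.\<close>
      have "G = (G - {{u, v}, {x, y}} \<union> {{u, x}, {v, y}}) - {{u, x}, {v, y}} \<union> {{u, v}, {x, y}}"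
        if "(G, x, y) \<in> Sigma R1 S" for G
        using that by (auto simp: R1_def S_def e)
      from this[OF pq(3)] this[OF pq(4)] have "E = E'" unfolding eq by (rule trans[OF _ sym])
      then show "p = q" by (simp add: pq)
    qed
    have "sw ` Sigma R1 S \<subseteq> Sigma R2 N"
    proof (rule image_subsetI)
      fix p assume p: "p \<in> Sigma R1 S"
      obtain E x y where pe: "p = (E, x, y)" by (metis surj_pair)
      have "regular_graph k V (E - {{u, v}, {x, y}} \<union> {{u, x}, {v, y}})"
        by (rule regular_graph_switch) (use p in \<open>auto simp: pe R1_def S_def e\<close>)
      \<comment> \<open>\<open>F\<close> survives because \<open>e \<notin> F\<close> and
        \<open>{x, y}\<close> was taken outside \<open>F\<close>; the added edges put
        \<open>x\<close> next to \<open>u\<close> and \<open>y\<close> next to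
        \<open>v\<close>.\<close>
      then show "sw p \<in> Sigma R2 N"
        using p assms(2) by (auto simp: pe sw_def R1_def R2_def S_def N_def e)
    qed
    then have "card (Sigma R1 S) \<le> card (Sigma R2 N)"
      using inj fin N by (intro card_inj_on_le[of sw]) auto
    also have "card (Sigma R2 N) = card R2 * k\<^sup>2" using fin N by simp
    finally have le: "card (Sigma R1 S) \<le> card R2 * k\<^sup>2" .
    have "card R1 * (k * card V - 2 * card F - 2 * k * (k + 1)) \<le> (\<Sum>E\<in>R1. card (S E))"
      using sum_mono[of R1 "\<lambda>_. k * card V - 2 * card F - 2 * k * (k + 1)" "\<lambda>E. card (S E)"] S
      by simp
    also have "\<dots> = card (Sigma R1 S)" using fin S by simp
    finally show ?thesis using le by (simp add: R1_def R2_def mult.commute)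
  qed
qed

text \<open>By \<open>card_regular_graphs_insert_edge\<close>, each further prescribed edge
  multiplies the count by at most \<open>k^2 / (k n / 4) = 4 k / n\<close>, where
  \<open>n = card V\<close>.\<close>

lemma card_regular_graphs_superset:
  assumes "finite V" "k > 0" "8 * (k + 1) \<le> card V" "finite F" "4 * card F \<le> k * card V"
  shows "real (card {E. regular_graph k V E \<and> F \<subseteq> E})
    \<le> (4 * real k / real (card V)) ^ card F * real (card {E. regular_graph k V E})"
  using assms(4,5)
proof (induction F rule: finite_induct)
  case empty
  then show ?case by simp
next
  case (insert e F)
  define n where "n = card V"
  define a where "a = real (card {E. regular_graph k V E \<and> insert e F \<subseteq> E})"
  define b where "b = real (card {E. regular_graph k V E \<and> F \<subseteq> E})"
  have n: "real n > 0" using assms(3) by (simp add: n_def)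
  have "k * (8 * (k + 1)) \<le> k * n" using assms by (intro mult_le_mono) (auto simp: n_def)
  \<comment> \<open>\<open>2 k (k + 1) \<le> k n / 4\<close> and
    \<open>2 card F \<le> k n / 2\<close>, so a quarter of \<open>k n\<close> remains.\<close>
  then have "k * n \<le> 4 * (k * n - 2 * card F - 2 * k * (k + 1))"
    using insert by (simp add: n_def algebra_simps)
  from mult_le_mono2[OF this]
  have "card {E. regular_graph k V E \<and> insert e F \<subseteq> E} * (k * n)
     \<le> 4 * (card {E. regular_graph k V E \<and> insert e F \<subseteq> E} *
         (k * n - 2 * card F - 2 * k * (k + 1)))"
    by (simp only: mult.left_commute[of 4])
  also have "\<dots> \<le> 4 * (k\<^sup>2 * card {E. regular_graph k V E \<and> F \<subseteq> E})"
    unfolding n_def by (intro mult_le_mono2 card_regular_graphs_insert_edge assms(1) insert(2))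
  finally have "real (card {E. regular_graph k V E \<and> insert e F \<subseteq> E} * (k * n))
     \<le> real (4 * (k\<^sup>2 * card {E. regular_graph k V E \<and> F \<subseteq> E}))"
    by (simp only: of_nat_le_iff)
  then have "real k * (a * n) \<le> real k * (4 * k * b)"
    by (simp add: a_def b_def algebra_simps power2_eq_square)
  then have "a * n \<le> 4 * k * b" using assms(2) mult_le_cancel_left_pos of_nat_0_less_iff by blast
  then have "a \<le> (4 * k / n) * b" using n by (simp add: field_simps)
  also have "\<dots> \<le> (4 * k / n) * ((4 * k / n) ^ card F * real (card {E. regular_graph k V E}))"
    unfolding b_def using insert n by (intro mult_left_mono) (auto simp: n_def)
  finally show ?case using insert by (simp add: a_def n_def mult.assoc)
qed

section \<open>Permutations that change few edges\<close>

text \<open>In a maximal \<open>A\<close> disjoint from its image, every \<open>b \<in> B\<close> lies in \<open>A\<close>, in its image or in its preimage.\<close>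

lemma disjoint_image_subset:
  fixes f :: "'b \<Rightarrow> 'b"
  assumes "finite B" "inj f" "\<And>b. b \<in> B \<Longrightarrow> f b \<noteq> b"
  shows "\<exists>A\<subseteq>B. A \<inter> f ` A = {} \<and> card B \<le> 3 * card A"
proof -
  let ?P = "\<lambda>A. A \<subseteq> B \<and> A \<inter> f ` A = {}"
  have "?P {}" by simp
  moreover have "\<forall>A. ?P A \<longrightarrow> card A < Suc (card B)"
    by (simp add: assms(1) card_mono less_Suc_eq_le)
  ultimately have "\<exists>A. ?P A \<and> (\<forall>A'. ?P A' \<longrightarrow> card A' \<le> card A)"
    by (rule ex_has_greatest_nat)
  then obtain A where "?P A \<and> (\<forall>A'. ?P A' \<longrightarrow> card A' \<le> card A)" ..
  then have A: "?P A" and max: "\<And>A'. ?P A' \<Longrightarrow> card A' \<le> card A" by simp_all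
  have fA: "finite A" using finite_subset[OF conjunct1[OF A] assms(1)] .
  have "B \<subseteq> A \<union> (f ` A \<union> f -` A)"
  proof
    fix b assume b: "b \<in> B"
    show "b \<in> A \<union> (f ` A \<union> f -` A)"
    proof (rule ccontr)
      assume *: "b \<notin> A \<union> (f ` A \<union> f -` A)"
      then have "f b \<notin> A" "b \<notin> f ` A" by auto
      then have "?P (insert b A)" using A b assms(3)[OF b] by (simp add: disjoint_iff)
      from max[OF this] * fA show False by simp
    qed
  qed
  then have "card B \<le> card (A \<union> (f ` A \<union> f -` A))"
    using fA assms(2) by (intro card_mono) (auto intro: finite_vimageI)
  also have "\<dots> \<le> card A + (card (f ` A) + card (f -` A))"
    by (meson card_Un_le add_le_mono le_trans order_refl)
  also have "card (f ` A) \<le> card A" using fA by (rule card_image_le)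
  also have "card (f -` A) \<le> card A" using card_vimage_inj_on_le[OF assms(2) fA] by simp
  finally show ?thesis using A by (intro exI[of _ A]) auto
qed

text \<open>Turns a failure of robustness for \<open>\<gamma> = 1\<close> into the presence of
  \<open>4 * card T\<close> prescribed edges, namely \<open>A\<close> and its image, to which the
  switching bound applies.\<close>

lemma almost_invariant_edges:
  assumes reg: "regular_graph k V E" and "16 \<le> k" and perm: "\<pi> permutes V"
  defines "T \<equiv> {v \<in> V. \<pi> v \<noteq> v}"
  assumes less: "card (sym_diff E {{\<pi> u, \<pi> v} |u v. {u, v} \<in> E}) < card T"
  shows "\<exists>A \<subseteq> (\<lambda>(u, v). {u, v}) ` (T \<times> V).
    card A = 2 * card T \<and> A \<inter> (`) \<pi> ` A = {} \<and> A \<union> (`) \<pi> ` A \<subseteq> E"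
proof -
  have simple: "simple_graph V E" using reg by (simp add: regular_graph_def)
  have edge: "\<exists>x y. e = {x, y}" if "e \<in> E" for e
  proof -
    have "card e = 2" using simple that by (simp add: simple_graph_def)
    then show ?thesis by (auto simp: card_2_iff)
  qed
  have finE: "finite E" by (rule simple_graph_finite_edges[OF simple])
  have finT: "finite T" using simple by (simp add: T_def simple_graph_def)
  have inj: "inj \<pi>" by (rule permutes_inj[OF perm])
  then have inj': "inj ((`) \<pi>)" by (simp add: inj_def inj_image_eq_iff)
  have img: "{{\<pi> u, \<pi> v} |u v. {u, v} \<in> E} = (`) \<pi> ` E"
  proof
    show "(`) \<pi> ` E \<subseteq> {{\<pi> u, \<pi> v} |u v. {u, v} \<in> E}"
    proof
      fix f assume "f \<in> (`) \<pi> ` E"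
      then obtain e where e: "e \<in> E" "f = \<pi> ` e" by auto
      from edge[OF e(1)] obtain x y where "e = {x, y}" by auto
      then show "f \<in> {{\<pi> u, \<pi> v} |u v. {u, v} \<in> E}" using e by auto
    qed
    have "{\<pi> u, \<pi> v} \<in> (`) \<pi> ` E" if "{u, v} \<in> E" for u v
      using imageI[OF that, of "(`) \<pi>"] by simp
    then show "{{\<pi> u, \<pi> v} |u v. {u, v} \<in> E} \<subseteq> (`) \<pi> ` E" by blast
  qed
  define ET where "ET = {e \<in> E. e \<inter> T \<noteq> {}}"
  have finET: "finite ET" using finE by (simp add: ET_def)
  \<comment> \<open>Double counting of pairs of a moved vertex and a neighbour: an edge with both
    ends in \<open>T\<close> counts twice.\<close>
  have c1: "k * card T \<le> 2 * card ET"
  proof -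
    have "k * card T = (\<Sum>v\<in>T. card {y. {v, y} \<in> E})"
      using card_neighbours[OF simple] reg by (simp add: regular_graph_def T_def)
    also have "\<dots> = card (SIGMA v:T. {y. {v, y} \<in> E})"
      using finT finite_neighbours[OF simple] by simp
    also have "\<dots> \<le> card {(x, y). {x, y} \<in> ET}"
      using card_ordered_edges_le[OF finET] by (intro card_mono) (auto simp: ET_def)
    also have "\<dots> \<le> 2 * card ET" using card_ordered_edges_le[OF finET] by simp
    finally show ?thesis .
  qed
  define Fi where "Fi = {e \<in> ET. \<pi> ` e = e}"
  define Out where "Out = {e \<in> ET. \<pi> ` e \<notin> E}"
  \<comment> \<open>A fixed edge through a moved vertex \<open>u\<close> has \<open>\<pi> u\<close>
    as its other end, so \<open>u\<close> determines it.\<close>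
  have "Fi \<subseteq> (\<lambda>u. {u, \<pi> u}) ` T"
  proof
    fix e assume e: "e \<in> Fi"
    then obtain u where u: "u \<in> e" "u \<in> T" "e \<in> E" "\<pi> ` e = e" by (auto simp: Fi_def ET_def)
    obtain x y where xy: "e = {x, y}" using edge[OF u(3)] by auto
    have "\<pi> u \<in> e" "\<pi> u \<noteq> u" using u by (auto simp: T_def)
    then have "e = {u, \<pi> u}" using u(1) unfolding xy by auto
    then show "e \<in> (\<lambda>u. {u, \<pi> u}) ` T" using u(2) by blast
  qed
  then have c2: "card Fi \<le> card T" by (rule surj_card_le[OF finT])
  \<comment> \<open>\<open>\<pi>\<close> acts injectively on edges and sends \<open>Out\<close> into
    the part of the symmetric difference outside \<open>E\<close>.\<close>
  have c3: "card Out \<le> card T"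
  proof -
    have "card Out = card ((`) \<pi> ` Out)" by (simp add: card_image inj_on_subset[OF inj'])
    also have "\<dots> \<le> card (sym_diff E ((`) \<pi> ` E))"
      using finE by (intro card_mono) (auto simp: Out_def ET_def)
    also have "\<dots> < card T" using less by (simp add: img)
    finally show ?thesis by simp
  qed
  define B where "B = ET - (Fi \<union> Out)"
  have "card ET - card (Fi \<union> Out) \<le> card B" unfolding B_def
    by (intro diff_card_le_card_Diff) (use finET in \<open>auto simp: Fi_def Out_def\<close>)
  moreover have "card (Fi \<union> Out) \<le> card Fi + card Out" by (rule card_Un_le)
  \<comment> \<open>With \<open>t = card T\<close>, this gives at least \<open>8 t\<close> edges in
    \<open>ET\<close>; removing at most \<open>t\<close> fixed and \<open>t\<close> lost ones leaves
    \<open>6 t\<close>.\<close>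
  moreover have "16 * card T \<le> k * card T" using assms(2) by simp
  ultimately have cB: "6 * card T \<le> card B" using c1 c2 c3 by linarith
  have "\<exists>A\<subseteq>B. A \<inter> (`) \<pi> ` A = {} \<and> card B \<le> 3 * card A"
    by (rule disjoint_image_subset[OF _ inj']) (use finET in \<open>auto simp: B_def Fi_def\<close>)
  then obtain A0 where A0: "A0 \<subseteq> B" "A0 \<inter> (`) \<pi> ` A0 = {}" "card B \<le> 3 * card A0"
    by (elim exE conjE)
  then have "2 * card T \<le> card A0" using cB by linarith
  \<comment> \<open>Disjointness from the image passes to subsets, so \<open>A0\<close> can be cut
    down and the union bound ranges over sets of one fixed size.\<close>
  then obtain A where A: "A \<subseteq> A0" "card A = 2 * card T"
    by (rule obtain_subset_with_card_n)
  have "e \<in> (\<lambda>(u, v). {u, v}) ` (T \<times> V)" if e: "e \<in> ET" for e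
  proof -
    obtain u where u: "u \<in> e" "u \<in> T" "e \<in> E" using e by (auto simp: ET_def)
    obtain x y where xy: "e = {x, y}" using edge[OF u(3)] by auto
    have "{x, y} \<in> E" using u(3) xy by simp
    note simple_graph_edgeD[OF simple this]
    moreover have "e = {u, x} \<or> e = {u, y}" using u(1) xy by auto
    ultimately show ?thesis using u(2) by (auto simp: image_iff)
  qed
  then have "A \<subseteq> (\<lambda>(u, v). {u, v}) ` (T \<times> V)" using A A0 by (auto simp: B_def)
  moreover have "A \<inter> (`) \<pi> ` A = {}" using A A0 by blast
  moreover have "A \<union> (`) \<pi> ` A \<subseteq> E" using A A0 by (auto simp: B_def ET_def Out_def)
  ultimately show ?thesis using A(2) by (intro exI[of _ A]) simp
qed

section \<open>Union bound over permutations and edge sets\<close>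

text \<open>After bounding the binomial by \<open>(t n)^(2 t) / (2 t)!\<close>, the factor
  \<open>t^(2 t) / (2 t)!\<close> is a single term of the exponential series at \<open>t\<close>,
  hence at most \<open>e^t\<close>.\<close>

lemma binomial_mult_le_exp:
  "real (t * n choose 2 * t) \<le> (exp 1 * real n ^ 2) ^ t"
proof -
  have "real (t * n choose 2 * t) * fact (2 * t) \<le> real (t * n) ^ (2 * t)"
    using binomial_fact_pow[of "t * n" "2 * t"] of_nat_le_iff[where 'a = real]
    by (metis of_nat_fact of_nat_mult of_nat_power)
  then have "real (t * n choose 2 * t) \<le> real (t * n) ^ (2 * t) / fact (2 * t)"
    by (simp add: pos_le_divide_eq)
  also have "\<dots> = (real t ^ (2 * t) / fact (2 * t)) * real n ^ (2 * t)"
    by (simp add: power_mult_distrib)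
  also have "real t ^ (2 * t) / fact (2 * t) \<le> exp (real t)"
  proof -
    have "(\<Sum>i\<in>{2 * t}. real t ^ i / fact i) \<le> (\<Sum>i. real t ^ i / fact i)"
      by (rule sum_le_suminf) (use summable_exp[of "real t"] in \<open>simp_all add: field_simps\<close>)
    then show ?thesis by (simp add: exp_def field_simps)
  qed
  also have "exp (real t) * real n ^ (2 * t) = (exp 1 * real n ^ 2) ^ t"
    by (simp add: power_mult_distrib power_mult exp_of_nat_mult[symmetric])
  finally show ?thesis by (simp add: mult_right_mono)
qed

lemma card_UN_le_mult:
  assumes "finite I" "\<And>i. i \<in> I \<Longrightarrow> real (card (X i)) \<le> c"
  shows "real (card (\<Union>i\<in>I. X i)) \<le> real (card I) * c"
proof -
  have "real (card (\<Union>i\<in>I. X i)) \<le> (\<Sum>i\<in>I. real (card (X i)))"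
    using card_UN_le[OF assms(1), of X] by (metis of_nat_le_iff of_nat_sum)
  also have "\<dots> \<le> (\<Sum>i\<in>I. c)" by (rule sum_mono[OF assms(2)])
  finally show ?thesis by simp
qed

text \<open>Union bound over the number \<open>t\<close> of moved vertices, in counting form: it
  makes sense even before regular graphs are known to exist.\<close>

lemma card_not_robust_le:
  assumes "finite V" "16 \<le> k" "8 * (k + 1) \<le> card V"
  defines "q \<equiv> exp 1 * (4 * real k) ^ 4 / real (card V)"
  shows "real (card {E. regular_graph k V E \<and> \<not> robustly_self_ordered 1 V E})
    \<le> (\<Sum>t=1..card V. q ^ t) * real (card {E. regular_graph k V E})"
proof -
  define n where "n = card V"
  define W where "W = real (card {E. regular_graph k V E})"
  \<comment> \<open>Covers all possible edges meeting \<open>T\<close>; pairs with equal entries add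
    singletons, a harmless overcount.\<close>
  define P where "P T = (\<lambda>(u, v). {u, v}) ` (T \<times> V)" for T
  define As where "As T \<pi> = {A. A \<subseteq> P T \<and> card A = 2 * card T \<and> A \<inter> (`) \<pi> ` A = {}}" for T and \<pi> :: "'a \<Rightarrow> 'a"
  define X where "X A \<pi> = {E. regular_graph k V E \<and> A \<union> (`) \<pi> ` A \<subseteq> E}" for A and \<pi> :: "'a \<Rightarrow> 'a"
  define Y where "Y t = (\<Union>T\<in>{T. T \<subseteq> V \<and> card T = t}. \<Union>\<pi>\<in>{\<pi>. \<pi> permutes T}. \<Union>A\<in>As T \<pi>. X A \<pi>)" for t
  have n: "real n > 0" using assms(3) by (simp add: n_def)
  have W: "W \<ge> 0" by (simp add: W_def)
  have finX: "finite (X A \<pi>)" for A \<pi>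
    unfolding X_def by (rule finite_regular_graphs[OF assms(1)])
  have finP: "finite (P T)" "card (P T) \<le> card T * n" if "T \<subseteq> V" for T
  proof -
    have "finite (T \<times> V)" using that assms(1) finite_subset by auto
    then show "finite (P T)" "card (P T) \<le> card T * n"
      unfolding P_def n_def using card_image_le[of "T \<times> V"] by (auto simp: card_cartesian_product)
  qed
  have finAs: "finite (As T \<pi>)" if "T \<subseteq> V" for T \<pi>
    by (rule finite_subset[of _ "Pow (P T)"]) (use finP[OF that] in \<open>auto simp: As_def\<close>)
  have cardAs: "real (card (As T \<pi>)) \<le> (exp 1 * real n ^ 2) ^ card T" if T: "T \<subseteq> V" for T \<pi>
  proof -
    have "card (As T \<pi>) \<le> card {A. A \<subseteq> P T \<and> card A = 2 * card T}"
      using finP[OF T] by (intro card_mono) (auto simp: As_def)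
    also have "\<dots> = card (P T) choose (2 * card T)" by (rule n_subsets[OF finP(1)[OF T]])
    also have "\<dots> \<le> card T * n choose (2 * card T)"
      using finP[OF T] by (intro binomial_right_mono)
    finally show ?thesis using binomial_mult_le_exp[of "card T" n] by linarith
  qed
  have cardX: "real (card (X A \<pi>)) \<le> (4 * real k / real n) ^ (4 * card T) * W"
    if T: "T \<subseteq> V" and \<pi>: "\<pi> permutes T" and A: "A \<in> As T \<pi>" for T \<pi> A
  proof -
    have finA: "finite A" using A finP[OF T] by (auto simp: As_def intro: finite_subset)
    have "inj ((`) \<pi>)" using permutes_inj[OF \<pi>] by (simp add: inj_def inj_image_eq_iff)
    then have "card ((`) \<pi> ` A) = card A" by (simp add: card_image inj_on_subset)
    then have c: "card (A \<union> (`) \<pi> ` A) = 4 * card T"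
      using A finA by (subst card_Un_disjoint) (auto simp: As_def)
    have "card T \<le> n" unfolding n_def by (rule card_mono[OF assms(1) T])
    \<comment> \<open>\<open>16 \<le> k\<close> leaves room to prescribe \<open>4 * card T\<close>
      edges even if every vertex moves.\<close>
    then have "16 * card T \<le> k * n" using assms(2) by (intro mult_le_mono)
    then have "4 * card (A \<union> (`) \<pi> ` A) \<le> k * card V" unfolding c n_def by simp
    then show ?thesis
      using card_regular_graphs_superset[of V k "A \<union> (`) \<pi> ` A"] assms finA
      unfolding c X_def W_def n_def by simp
  qed
  have cardY: "real (card (Y t)) \<le> q ^ t * W" for t
  proof -
    define K where "K = (4 * real k / real n) ^ (4 * t) * W"
    have K: "K \<ge> 0" using W by (simp add: K_def)
    have 1: "real (card (\<Union>A\<in>As T \<pi>. X A \<pi>)) \<le> (exp 1 * real n ^ 2) ^ t * K"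
      if "T \<subseteq> V" "card T = t" "\<pi> permutes T" for T \<pi>
    proof -
      have "real (card (\<Union>A\<in>As T \<pi>. X A \<pi>)) \<le> real (card (As T \<pi>)) * K"
        by (rule card_UN_le_mult) (use that finAs cardX[of T \<pi>] in \<open>auto simp: K_def\<close>)
      also have "\<dots> \<le> (exp 1 * real n ^ 2) ^ t * K"
        using cardAs[of T \<pi>] that K by (intro mult_right_mono) auto
      finally show ?thesis .
    qed
    have 2: "real (card (\<Union>\<pi>\<in>{\<pi>. \<pi> permutes T}. \<Union>A\<in>As T \<pi>. X A \<pi>))
        \<le> fact t * ((exp 1 * real n ^ 2) ^ t * K)" if "T \<subseteq> V" "card T = t" for T
    proof -
      have T: "finite T" using that assms(1) finite_subset by blast
      have "real (card (\<Union>\<pi>\<in>{\<pi>. \<pi> permutes T}. \<Union>A\<in>As T \<pi>. X A \<pi>))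
        \<le> real (card {\<pi>. \<pi> permutes T}) * ((exp 1 * real n ^ 2) ^ t * K)"
        by (rule card_UN_le_mult) (use T finite_permutations 1 that in auto)
      then show ?thesis using card_permutations[OF that(2) T] by simp
    qed
    have "real (card (Y t)) \<le> real (card {T. T \<subseteq> V \<and> card T = t}) * (fact t * ((exp 1 * real n ^ 2) ^ t * K))"
      unfolding Y_def by (rule card_UN_le_mult) (use 2 assms(1) in auto)
    also have "card {T. T \<subseteq> V \<and> card T = t} = n choose t"
      unfolding n_def by (rule n_subsets[OF assms(1)])
    \<comment> \<open>The factorial from the permutations cancels the one in the binomial: the
      product is a falling factorial, at most \<open>n^t\<close>.\<close>
    also have "real (n choose t) * (fact t * ((exp 1 * real n ^ 2) ^ t * K))
       = real ((n choose t) * fact t) * ((exp 1 * real n ^ 2) ^ t * K)"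
      by simp
    also have "\<dots> \<le> real (n ^ t) * ((exp 1 * real n ^ 2) ^ t * K)"
      using K binomial_fact_pow[of n t] by (intro mult_right_mono) (auto simp only: of_nat_le_iff intro!: mult_nonneg_nonneg zero_le_power exp_ge_zero of_nat_0_le_iff)
    also have "\<dots> = (real n * (exp 1 * real n ^ 2) * (4 * real k / real n) ^ 4) ^ t * W"
      by (simp add: K_def power_mult_distrib power_mult)
    \<comment> \<open>The exponents of \<open>n\<close> add up to \<open>1 + 2 - 4 = -1\<close>: the
      prescribed edges outweigh all the choices.\<close>
    also have "real n * (exp 1 * real n ^ 2) * (4 * real k / real n) ^ 4 = q"
      using n unfolding q_def n_def[symmetric]
      by (simp add: power_divide field_simps power2_eq_square power4_eq_xxxx)
    finally show ?thesis .
  qed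
  have finY: "finite (Y t)" for t
    unfolding Y_def using assms(1) finX finAs
    by (intro finite_UN_I) (auto intro: finite_permutations finite_subset)
  have "{E. regular_graph k V E \<and> \<not> robustly_self_ordered 1 V E} \<subseteq> (\<Union>t\<in>{1..n}. Y t)"
  proof
    fix E assume "E \<in> {E. regular_graph k V E \<and> \<not> robustly_self_ordered 1 V E}"
    then have reg: "regular_graph k V E" and "\<not> robustly_self_ordered 1 V E" by auto
    then obtain \<pi> where \<pi>: "\<pi> permutes V"
      and less: "card (sym_diff E {{\<pi> u, \<pi> v} |u v. {u, v} \<in> E}) < card {v \<in> V. \<pi> v \<noteq> v}"
      by (auto simp: robustly_self_ordered_def not_le)
    define T where "T = {v \<in> V. \<pi> v \<noteq> v}"
    have T: "T \<subseteq> V" by (auto simp: T_def)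
    have \<pi>T: "\<pi> permutes T"
      by (rule permutes_superset[OF \<pi>]) (auto simp: T_def)
    obtain A where "A \<in> As T \<pi>" "A \<union> (`) \<pi> ` A \<subseteq> E"
      using almost_invariant_edges[OF reg assms(2) \<pi> less] by (auto simp: As_def P_def T_def)
    then have "E \<in> Y (card T)" using T \<pi>T reg by (auto simp: Y_def X_def)
    \<comment> \<open>The strict inequality in \<open>less\<close> forces \<open>T\<close> to be
      nonempty, so the sum starts at \<open>t = 1\<close>.\<close>
    moreover have "card T \<in> {1..n}"
      using less card_mono[OF assms(1) T] by (auto simp: T_def n_def)
    ultimately show "E \<in> (\<Union>t\<in>{1..n}. Y t)" by blast
  qed
  then have "card {E. regular_graph k V E \<and> \<not> robustly_self_ordered 1 V E} \<le> card (\<Union>t\<in>{1..n}. Y t)"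
    using finY by (intro card_mono) auto
  also have "\<dots> \<le> (\<Sum>t=1..n. card (Y t))" by (rule card_UN_le) simp
  finally have "real (card {E. regular_graph k V E \<and> \<not> robustly_self_ordered 1 V E})
     \<le> (\<Sum>t=1..n. real (card (Y t)))"
    by (simp only: of_nat_sum[symmetric] of_nat_le_iff)
  also have "\<dots> \<le> (\<Sum>t=1..n. q ^ t * W)" by (rule sum_mono[OF cardY])
  finally show ?thesis by (simp add: sum_distrib_right W_def n_def)
qed

lemma sum_power_le_twice:
  fixes q :: real
  assumes "0 \<le> q" "2 * q \<le> 1"
  shows "(\<Sum>t=1..n. q ^ t) \<le> 2 * q"
proof -
  \<comment> \<open>The extra summand makes the claim inductive: \<open>2 * q \<le> 1\<close> lets
    half of it pay for the next remainder.\<close>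
  have "(\<Sum>t=1..n. q ^ t) + 2 * q ^ Suc n \<le> 2 * q"
  proof (induction n)
    case (Suc n)
    have "(2 * q) * q ^ Suc n \<le> 1 * q ^ Suc n" using assms by (intro mult_right_mono) auto
    with Suc show ?case by simp
  qed simp
  moreover have "0 \<le> q ^ Suc n" using assms by simp
  ultimately show ?thesis by linarith
qed

section \<open>Existence of regular graphs of even degree\<close>

text \<open>Ensures that \<open>pmf_of_set\<close> is taken over a nonempty set, so that
  probabilities are quotients of cardinalities.\<close>

lemma regular_graph_exists:
  assumes "2 * d < n"
  shows "\<exists>E. regular_graph (2 * d) {1..n} E"
proof -
  \<comment> \<open>The circulant graph joining residues modulo \<open>n\<close> at cyclic distance at most \<open>d\<close>.\<close>
  define g where "g z = Suc (nat (z mod int n))" for z :: int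
  have n: "0 < int n" using assms by simp
  have g_eq: "g z = g z' \<longleftrightarrow> int n dvd z - z'" for z z'
    using n by (simp add: g_def mod_eq_dvd_iff nat_eq_iff)
  have g_mem: "g z \<in> {1..n}" for z
    using n pos_mod_bound[OF n, of z] by (auto simp: g_def nat_less_iff Suc_le_eq)
  have g_surj: "\<exists>z. w = g z" if "w \<in> {1..n}" for w
    using that n by (intro exI[of _ "int w - 1"]) (auto simp: g_def nat_diff_distrib)
  \<comment> \<open>Two offsets of absolute value at most \<open>d\<close> differ by at most
    \<open>2 d < n\<close>, so congruent ones coincide.\<close>
  have small: "x = 0" if "int n dvd x" "\<bar>x\<bar> \<le> 2 * int d" for x
    using that assms by (metis dvd_imp_le_int linorder_not_less of_nat_less_iff of_nat_mult of_nat_numeral abs_of_nat le_less_trans)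
  define J where "J = {- int d..int d} - {0}"
  define E where "E = {{g z, g (z + j)} |z j. 1 \<le> j \<and> j \<le> int d}"
  have cJ: "card J = 2 * d" by (simp add: J_def)
  \<comment> \<open>An edge is generated with a positive offset from one end; from the other end the
    offset is negative, hence \<open>J\<close>.\<close>
  have edges: "{e \<in> E. g z \<in> e} = (\<lambda>j. {g z, g (z + j)}) ` J" for z
  proof (intro equalityI subsetI)
    fix e assume "e \<in> {e \<in> E. g z \<in> e}"
    then obtain z' j where e: "e = {g z', g (z' + j)}" "1 \<le> j" "j \<le> int d" "g z = g z' \<or> g z = g (z' + j)"
      by (auto simp: E_def)
    from e(4) show "e \<in> (\<lambda>j. {g z, g (z + j)}) ` J"
    proof
      assume "g z = g z'"
      moreover then have "g (z + j) = g (z' + j)" by (simp add: g_eq)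
      ultimately show ?thesis using e by (intro image_eqI[of _ _ j]) (auto simp: J_def)
    next
      assume "g z = g (z' + j)"
      moreover then have "g (z + - j) = g z'" by (simp add: g_eq algebra_simps)
      ultimately show ?thesis using e by (intro image_eqI[of _ _ "- j"]) (auto simp: J_def)
    qed
  next
    fix e assume "e \<in> (\<lambda>j. {g z, g (z + j)}) ` J"
    then obtain j where j: "j \<in> J" "e = {g z, g (z + j)}" by auto
    have "e \<in> E"
    proof (cases "j > 0")
      case True
      then have "1 \<le> j" "j \<le> int d" using j by (auto simp: J_def)
      then show ?thesis unfolding E_def j(2) by blast
    next
      case False
      have "e = {g (z + j), g ((z + j) + - j)}" using j by auto
      moreover have "1 \<le> - j" "- j \<le> int d" using False j by (auto simp: J_def)
      ultimately show ?thesis unfolding E_def by blast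
    qed
    then show "e \<in> {e \<in> E. g z \<in> e}" using j by auto
  qed
  have "inj_on (\<lambda>j. {g z, g (z + j)}) J" for z
  proof (rule inj_onI)
    fix i j assume ij: "i \<in> J" "j \<in> J" "{g z, g (z + i)} = {g z, g (z + j)}"
    have abs: "\<bar>i\<bar> \<le> 2 * int d" "\<bar>i - j\<bar> \<le> 2 * int d" "i \<noteq> 0"
      using ij(1,2) by (auto simp: J_def)
    have "g (z + i) \<noteq> g z" using small[of i] abs by (auto simp: g_eq)
    then have "g (z + i) = g (z + j)" using ij(3) by (auto simp: doubleton_eq_iff)
    then show "i = j" using small[of "i - j"] abs by (simp add: g_eq)
  qed
  then have deg: "degree E (g z) = 2 * d" for z
    by (simp add: degree_def edges card_image cJ)
  have "g z \<noteq> g (z + j)" if "1 \<le> j" "j \<le> int d" for z j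
    using that small[of j] small[of "- j"] by (auto simp: g_eq)
  then have "simple_graph {1..n} E"
    using g_mem by (auto simp: simple_graph_def E_def)
  moreover have "degree E w = 2 * d" if "w \<in> {1..n}" for w
    using deg g_surj[OF that] by auto
  ultimately have "regular_graph (2 * d) {1..n} E" by (simp add: regular_graph_def)
  then show ?thesis ..
qed

section \<open>Convergence of the probability\<close>

theorem theorem6p1:
  "\<exists>d0::nat. \<forall>d\<ge>d0. \<exists>\<gamma>::real. \<gamma> > 0 \<and>
     (\<lambda>n. measure_pmf.prob (random_regular_graph (2 * d) n)
            {E. robustly_self_ordered \<gamma> {1..n} E}) \<longlonglongrightarrow> 1"
\<comment> \<open>\<open>d \<ge> 8\<close> is the condition \<open>16 \<le> k\<close> for
  \<open>k = 2 d\<close>, and \<open>\<gamma> = 1\<close> serves for all such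
  \<open>d\<close>.\<close>
proof (rule exI[of _ 8], intro allI impI, rule exI[of _ 1], intro conjI)
  fix d :: nat assume d: "8 \<le> d"
  define k where "k = 2 * d"
  define c where "c = exp 1 * (4 * real k) ^ 4"
  define p where "p n = measure_pmf.prob (random_regular_graph k n) {E. robustly_self_ordered 1 {1..n} E}" for n
  have lower: "1 - 2 * c / real n \<le> p n" if n: "8 * (k + 1) \<le> n" "2 * c \<le> real n" for n
  proof -
    define R where "R = {E. regular_graph k {1..n} E}"
    define S where "S = {E. robustly_self_ordered 1 {1..n} E}"
    define q where "q = c / real n"
    have n0: "real n > 0" using n(1) by simp
    have R: "finite R" "R \<noteq> {}"
      using finite_regular_graphs[of "{1..n}" k "\<lambda>_. True"] regular_graph_exists[of d n] n
      by (auto simp: R_def k_def)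
    then have cR: "real (card R) > 0" by (simp add: card_gt_0_iff)
    have "real (card (R \<inter> - S)) \<le> (\<Sum>t=1..n. q ^ t) * real (card R)"
      using card_not_robust_le[of "{1..n}" k] d n
      by (simp add: R_def S_def q_def c_def k_def Int_def)
    \<comment> \<open>\<open>2 * c \<le> real n\<close> says that \<open>2 * q \<le> 1\<close>, as
      the geometric sum requires.\<close>
    also have "\<dots> \<le> 2 * q * real (card R)"
      using n n0 by (intro mult_right_mono sum_power_le_twice) (auto simp: q_def c_def)
    finally have "real (card (R \<inter> - S)) / real (card R) \<le> 2 * q"
      using cR by (simp add: divide_le_eq)
    moreover have "measure_pmf.prob (random_regular_graph k n) (- S)
        = real (card (R \<inter> - S)) / real (card R)"
      using measure_pmf_of_set[OF R(2,1), of "- S"] by (simp add: random_regular_graph_def R_def)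
    moreover have "measure_pmf.prob (random_regular_graph k n) (- S) = 1 - p n"
      using measure_pmf.prob_compl[of S "random_regular_graph k n"]
      by (simp add: p_def S_def Compl_eq_Diff_UNIV)
    ultimately show ?thesis by (simp add: q_def)
  qed
  have ev: "eventually (\<lambda>n. 1 - 2 * c / real n \<le> p n) sequentially"
  proof (rule eventually_sequentiallyI)
    fix n assume "max (8 * (k + 1)) (nat \<lceil>2 * c\<rceil>) \<le> n"
    then have n: "8 * (k + 1) \<le> n" "nat \<lceil>2 * c\<rceil> \<le> n" by simp_all
    have "2 * c \<le> real (nat \<lceil>2 * c\<rceil>)" by (rule real_nat_ceiling_ge)
    also have "\<dots> \<le> real n" using n(2) by (simp only: of_nat_le_iff)
    finally show "1 - 2 * c / real n \<le> p n" by (rule lower[OF n(1)])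
  qed
  have "(\<lambda>n. 1 - 2 * c / real n) \<longlonglongrightarrow> 1 - 0"
    by (intro tendsto_diff tendsto_const lim_const_over_n)
  then have lim: "(\<lambda>n. 1 - 2 * c / real n) \<longlonglongrightarrow> 1" by simp
  have upper: "eventually (\<lambda>n. p n \<le> 1) sequentially"
    by (rule always_eventually) (simp add: p_def)
  have "p \<longlonglongrightarrow> 1"
    using ev upper lim tendsto_const by (rule tendsto_sandwich)
  then show "(\<lambda>n. measure_pmf.prob (random_regular_graph (2 * d) n)
            {E. robustly_self_ordered 1 {1..n} E}) \<longlonglongrightarrow> 1"
    unfolding p_def k_def .
qed simp

end
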